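(* Let $\nu\ge 0$, $\alpha>0$, and let $f\in C^\infty(0,\infty)$ have support $[a,b]$ with $0<a<b<\infty$. Then for all $x>0$ $$ (B_{\nu,-}^{-\alpha}f)(x)=\frac{\Gamma\left(\alpha+\frac12\right)}{\Gamma(2\alpha)}\int_x^{\infty}(y^2-x^2)^{\alpha-\frac12}\left(\frac{y}{x}\right)^{\frac{\nu}{2}}P_{\frac{\nu}{2}-1}^{\frac12-\alpha}\left[\frac12\left(\frac{x}{y}+\frac{y}{x}\right)\right]f(y)\,dy . $$
   Context: For $\nu\ge 0$, $\alpha>0$ the fractional Bessel integral on the semiaxis $(0,\infty)$ is defined by $$ (B_{\nu,-}^{-\alpha}f)(x)=\frac{1}{\Gamma(2\alpha)}\int_x^{+\infty}\left(\frac{y^2-x^2}{2y}\right)^{2\alpha-1}{}_2F_1\left(\alpha+\frac{\nu-1}{2},\alpha;2\alpha;1-\frac{x^2}{y^2}\right)f(y)\,dy,\qquad x>0, $$ where ${}_2F_1$ is the Gauss hypergeometric function. $P_\lambda^\mu(w)$, for $w>1$, denotes the associated Legendre function of the first kind (with the standard normalization off the cut, $P_\lambda^\mu(w)=\frac{1}{\Gamma(1-\mu)}\left(\frac{w+1}{w-1}\right)^{\mu/2}{}_2F_1\left(-\lambda,\lambda+1;1-\mu;\frac{1-w}{2}\right)$). *)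

theory Defs
  imports "HOL-Complex_Analysis.Complex_Analysis"
begin

(* D n is the n-th derivative; S is meant to be open. *)
definition smooth_on :: "real set \<Rightarrow> (real \<Rightarrow> complex) \<Rightarrow> bool" where
  "smooth_on S f \<longleftrightarrow> (\<exists>D :: nat \<Rightarrow> real \<Rightarrow> complex.
     (\<forall>x\<in>S. D 0 x = f x) \<and>
     (\<forall>n. \<forall>x\<in>S. (D n has_vector_derivative D (Suc n) x) (at x)))"

(* The Gauss function is the sum of the hypergeometric series on the unit disc and, elsewhere,
   its analytic continuation along the segment from 0 to z.  This is the principal branch, with
   cut [1, \<infinity>).  The continuation is needed even for real arguments, since the Legendre
   function below evaluates it at (1 - w) / 2, which is less than -1 when w > 3. *)
definition gauss_continuation ::
    "complex \<Rightarrow> complex \<Rightarrow> complex \<Rightarrow> complex set \<Rightarrow> (complex \<Rightarrow> complex) \<Rightarrow> bool" where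
  "gauss_continuation a b c S g \<longleftrightarrow>
     open S \<and> (\<forall>s\<in>S. closed_segment 0 s \<subseteq> S) \<and> g holomorphic_on S \<and>
     (\<forall>s \<in> S \<inter> ball 0 1. g s = eval_fps (fps_hypergeo [a, b] [c] 1) s)"

definition gauss_2F1 :: "complex \<Rightarrow> complex \<Rightarrow> complex \<Rightarrow> complex \<Rightarrow> complex" where
  "gauss_2F1 a b c z = (THE v. \<exists>S g. gauss_continuation a b c S g \<and> z \<in> S \<and> v = g z)"

lemma gauss_continuation_unique:
  assumes 1: "gauss_continuation a b c S g" "z \<in> S"
    and 2: "gauss_continuation a b c S' g'" "z \<in> S'"
  shows "g z = g' z"
proof -
  let ?T = "S \<inter> S'"
  have seg: "closed_segment 0 s \<subseteq> ?T" if "s \<in> ?T" for s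
    using 1 2 that unfolding gauss_continuation_def by blast
  have 0: "0 \<in> ?T"
    using seg[of z] 1 2 by auto
  have "starlike ?T"
    unfolding starlike_def using 0 seg by blast
  then have con: "connected ?T"
    by (rule starlike_imp_connected)
  show ?thesis
  proof (rule analytic_continuation_open[of "?T \<inter> ball 0 1" ?T g g'])
    show "open (?T \<inter> ball 0 1)" "open ?T"
      using 1 2 unfolding gauss_continuation_def by auto
    show "?T \<inter> ball 0 1 \<noteq> {}"
      using 0 by (auto intro!: exI[of _ 0])
    show "g holomorphic_on ?T" "g' holomorphic_on ?T"
      using 1 2 unfolding gauss_continuation_def by (auto intro: holomorphic_on_subset)
    show "g s = g' s" if "s \<in> ?T \<inter> ball 0 1" for s
      using 1 2 that unfolding gauss_continuation_def by auto
  qed (use con 1 2 in auto)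
qed

lemma gauss_2F1_eqI:
  assumes "gauss_continuation a b c S g" "z \<in> S"
  shows "gauss_2F1 a b c z = g z"
  unfolding gauss_2F1_def
  using assms gauss_continuation_unique by (intro the_equality) blast+

(* Intended for w > 1, where (w + 1) / (w - 1) is positive and the real power is the
   standard one. *)
definition legendre_P :: "real \<Rightarrow> real \<Rightarrow> real \<Rightarrow> complex" where
  "legendre_P \<kappa> \<mu> w =
     of_real (1 / Gamma (1 - \<mu>) * ((w + 1) / (w - 1)) powr (\<mu> / 2)) *
     gauss_2F1 (of_real (- \<kappa>)) (of_real (\<kappa> + 1)) (of_real (1 - \<mu>)) (of_real ((1 - w) / 2))"

definition bessel_integral :: "real \<Rightarrow> real \<Rightarrow> (real \<Rightarrow> complex) \<Rightarrow> real \<Rightarrow> complex" where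
  "bessel_integral \<nu> \<alpha> f x =
     of_real (1 / Gamma (2 * \<alpha>)) *
     (LINT y:{x<..}|lborel.
        of_real (((y\<^sup>2 - x\<^sup>2) / (2 * y)) powr (2 * \<alpha> - 1)) *
        gauss_2F1 (of_real (\<alpha> + (\<nu> - 1) / 2)) (of_real \<alpha>) (of_real (2 * \<alpha>))
          (of_real (1 - x\<^sup>2 / y\<^sup>2)) *
        f y)"

end

(* Put t = x / y and r = (1 - t) / (1 + t).  The argument of the Gauss function in the Bessel kernel is
   1 - t^2 = 4 r / (1 + r)^2, and that of the one in the Legendre function is z = - (1 - t)^2 / (4 t), with
   z / (z - 1) = r^2.  Gauss' quadratic transformation
     F(a, b; 2 b; 4 r / (1 + r)^2) = (1 + r)^(2 a) F(a, a - b + 1/2; b + 1/2; r^2)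
   for the former and Pfaff's transformation
     F(a, b; c; z) = (1 - z)^(-a) F(a, c - b; c; z / (z - 1))
   for the latter express both through the same series in r^2, so that the two kernels agree
   pointwise.  Pfaff's transformation also yields the continuation of the series to Re z < 1/2. *)

theory Submission
  imports Defs
begin

unbundle no vec_syntax

section \<open>The hypergeometric series: coefficient recurrence and convergence\<close>

text \<open>Clearing denominators turns the recurrence into a ring identity, the form in which the
  differential equation is later compared coefficient by coefficient.\<close>

lemma fps_hypergeo_2F1_Suc:
  fixes a b c :: "'a :: field_char_0"
  assumes "\<And>n. c + of_nat n \<noteq> 0"
  shows "of_nat (Suc n) * (c + of_nat n) * fps_hypergeo [a, b] [c] 1 $ Suc n =
    (a + of_nat n) * (b + of_nat n) * fps_hypergeo [a, b] [c] 1 $ n"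
proof -
  have "s * d * (A / (s * d) * F) = A * F" if "s \<noteq> 0" "d \<noteq> 0" for s d A F :: 'a
    using that by simp
  from this[OF of_nat_neq_0 assms] show ?thesis
    unfolding fps_hypergeo_rec foldl.simps mult_1 by blast
qed

text \<open>The factor leading from one coefficient to the next tends to 1, so the ratio test
  applies on the unit disc. Only a lower bound holds in general, because the series terminates when
  \<open>a\<close> or \<open>b\<close> is a nonpositive integer.\<close>

lemma fps_conv_radius_hypergeo_2F1:
  fixes a b c :: complex
  assumes c: "\<And>n. c + of_nat n \<noteq> 0"
  shows "fps_conv_radius (fps_hypergeo [a, b] [c] 1) \<ge> 1"
proof -
  define f where "f = fps_nth (fps_hypergeo [a, b] [c] (1 :: complex))"
  define u where "u n = (a + of_nat n) * (b + of_nat n) / (of_nat (Suc n) * (c + of_nat n))" for n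
  have f_Suc: "f (Suc n) = u n * f n" for n
  proof -
    have "F = A / d * G" if "d * F = A * G" "d \<noteq> 0" for d A F G :: complex
      using that by (simp add: nonzero_eq_divide_eq mult_ac)
    moreover have "of_nat (Suc n) * (c + of_nat n) \<noteq> 0"
      using c[of n] of_nat_neq_0[of n, where 'a = complex] by (simp del: of_nat_Suc)
    ultimately show ?thesis
      unfolding f_def u_def using fps_hypergeo_2F1_Suc[OF c] by blast
  qed
  have inv: "(\<lambda>n. inverse (of_nat n :: complex)) \<longlonglongrightarrow> 0"
    by (rule lim_inverse_n)
  \<comment> \<open>This is \<open>u n\<close> with numerator and denominator divided by n^2, which
    is legitimate for n > 0 only.\<close>
  have "(\<lambda>n. (a * inverse (of_nat n) + 1) * (b * inverse (of_nat n) + 1) /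
      ((1 + inverse (of_nat n)) * (c * inverse (of_nat n) + 1))) \<longlonglongrightarrow>
      (a * 0 + 1) * (b * 0 + 1) / ((1 + 0) * (c * 0 + 1))"
    by (intro tendsto_intros inv) auto
  moreover have "\<forall>\<^sub>F n in sequentially. (a * inverse (of_nat n) + 1) * (b * inverse (of_nat n) + 1) /
      ((1 + inverse (of_nat n)) * (c * inverse (of_nat n) + 1)) = u n"
    using eventually_gt_at_top[of 0]
  proof eventually_elim
    case (elim n)
    then have n: "of_nat n \<noteq> (0 :: complex)"
      by simp
    have eqs: "a * inverse (of_nat n) + 1 = (a + of_nat n) / of_nat n"
      "b * inverse (of_nat n) + 1 = (b + of_nat n) / of_nat n"
      "c * inverse (of_nat n) + 1 = (c + of_nat n) / of_nat n"
      "1 + inverse (of_nat n) = (of_nat (Suc n) / of_nat n :: complex)"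
      using n by (auto simp: field_simps)
    have "(A / N) * (B / N) / ((S / N) * (C / N)) = A * B / (S * C)" if "N \<noteq> 0"
      for A B C S N :: complex
      using that by (cases "S = 0"; cases "C = 0") (simp_all add: field_simps)
    from this[OF n] show ?case
      unfolding eqs u_def .
  qed
  ultimately have "u \<longlonglongrightarrow> 1"
    by (auto intro: Lim_transform_eventually)
  then have u: "(\<lambda>n. norm (u n)) \<longlonglongrightarrow> 1"
    using tendsto_norm by fastforce
  have "conv_radius f \<ge> 1"
  proof (rule conv_radius_geI_ex')
    fix r :: real
    assume r: "0 < r" "ereal r < 1"
    \<comment> \<open>The midpoint of r and 1: as \<rho> / r > 1, the norm of \<open>u n\<close> is
      eventually below \<rho> / r, and \<rho> < 1 then serves as the ratio.\<close>
    define \<rho> where "\<rho> = (r + 1) / 2"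
    have \<rho>: "r < \<rho>" "\<rho> < 1"
      using r by (auto simp: \<rho>_def)
    then have "1 < \<rho> / r"
      using r by (simp add: field_simps)
    then obtain N where N: "\<And>n. n \<ge> N \<Longrightarrow> norm (u n) < \<rho> / r"
      using order_tendstoD(2)[OF u] unfolding eventually_sequentially by blast
    show "summable (\<lambda>n. f n * of_real r ^ n)"
    proof (rule summable_ratio_test[OF \<rho>(2)])
      fix n assume "n \<ge> N"
      then have "norm (u n) * r \<le> \<rho>"
        using N[of n] r by (simp add: field_simps)
      then have "(norm (u n) * r) * (norm (f n) * r ^ n) \<le> \<rho> * (norm (f n) * r ^ n)"
        using r by (intro mult_right_mono) auto
      then show "norm (f (Suc n) * of_real r ^ Suc n) \<le> \<rho> * norm (f n * of_real r ^ n)"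
        using r by (simp add: f_Suc norm_mult norm_power mult_ac)
    qed
  qed
  then show ?thesis
    unfolding fps_conv_radius_def f_def .
qed

lemma holomorphic_on_hypergeo_2F1:
  fixes a b c :: complex
  assumes "\<And>n. c + of_nat n \<noteq> 0"
  shows "eval_fps (fps_hypergeo [a, b] [c] 1) holomorphic_on ball 0 1"
  using fps_conv_radius_hypergeo_2F1[OF assms, of a b]
  by (intro holomorphic_on_eval_fps ball_eball_mono) (simp add: one_ereal_def)

section \<open>The hypergeometric differential equation\<close>

text \<open>A polynomial converges everywhere and does not spoil the convergence of
  \<open>G\<close>. The second fact is what allows sums of such products to be evaluated
  termwise.\<close>

lemma eval_fps_poly_mult:
  fixes G :: "complex fps"
  assumes "norm z < fps_conv_radius G"
  shows "eval_fps (fps_of_poly p * G) z = poly p z * eval_fps G z"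
    and "norm z < fps_conv_radius (fps_of_poly p * G)"
  using assms fps_conv_radius_mult[of "fps_of_poly p" G]
  by (auto simp: eval_fps_mult intro: less_le_trans)

text \<open>The coefficient of index n on the left collapses to the recurrence between the
  coefficients n and n + 1 of \<open>F\<close>.\<close>

lemma hypergeo_2F1_ode_fps:
  fixes a b c :: "'a :: field_char_0"
  assumes c: "\<And>n. c + of_nat n \<noteq> 0"
  defines "F \<equiv> fps_hypergeo [a, b] [c] 1"
  shows "fps_of_poly [:0, 1, -1:] * fps_deriv (fps_deriv F) +
    fps_of_poly [:c, - (a + b + 1):] * fps_deriv F - fps_of_poly [:a * b:] * F = 0"
proof (rule fps_ext)
  fix n
  have rec: "of_nat (Suc n) * (c + of_nat n) * F $ Suc n =
      (a + of_nat n) * (b + of_nat n) * F $ n"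
    unfolding F_def by (rule fps_hypergeo_2F1_Suc[OF c])
  show "(fps_of_poly [:0, 1, -1:] * fps_deriv (fps_deriv F) +
      fps_of_poly [:c, - (a + b + 1):] * fps_deriv F - fps_of_poly [:a * b:] * F) $ n = 0 $ n"
  proof (cases n)
    case 0
    then show ?thesis
      using rec by (simp add: fps_of_poly_pCons algebra_simps)
  next
    case (Suc m)
    then show ?thesis
      \<comment> \<open>The term X^2 F'' shifts indices by two, so n = 1 has to be separated as
        well.\<close>
      using rec by (cases m) (simp_all add: fps_of_poly_pCons algebra_simps)
  qed
qed

lemma hypergeo_2F1_ode:
  fixes a b c :: complex
  assumes c: "\<And>n. c + of_nat n \<noteq> 0" and z: "norm z < 1"
  defines "F \<equiv> fps_hypergeo [a, b] [c] 1"
  shows "z * (1 - z) * eval_fps (fps_deriv (fps_deriv F)) z +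
    (c - (a + b + 1) * z) * eval_fps (fps_deriv F) z - a * b * eval_fps F z = 0"
proof -
  have "fps_conv_radius F \<ge> 1"
    unfolding F_def by (rule fps_conv_radius_hypergeo_2F1[OF c])
  then have F: "norm z < fps_conv_radius F"
    using z by (metis ereal_less(3) order_less_le_trans)
  have F': "norm z < fps_conv_radius (fps_deriv F)"
    using F fps_conv_radius_deriv[of F] by (rule less_le_trans)
  have F'': "norm z < fps_conv_radius (fps_deriv (fps_deriv F))"
    using F' fps_conv_radius_deriv[of "fps_deriv F"] by (rule less_le_trans)
  let ?P2 = "fps_of_poly [:0, 1, -1:] * fps_deriv (fps_deriv F)"
  let ?P1 = "fps_of_poly [:c, - (a + b + 1):] * fps_deriv F"
  let ?P0 = "fps_of_poly [:a * b:] * F"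
  note P = eval_fps_poly_mult[OF F] eval_fps_poly_mult[OF F'] eval_fps_poly_mult[OF F'']
  have "norm z < min (fps_conv_radius ?P2) (fps_conv_radius ?P1)"
    using P(4,6) by simp
  then have "norm z < fps_conv_radius (?P2 + ?P1)"
    using fps_conv_radius_add by (rule less_le_trans)
  then have "eval_fps (?P2 + ?P1 - ?P0) z = eval_fps ?P2 z + eval_fps ?P1 z - eval_fps ?P0 z"
    using P(2,4,6) by (simp add: eval_fps_add eval_fps_diff)
  moreover have "?P2 + ?P1 - ?P0 = 0"
    unfolding F_def by (rule hypergeo_2F1_ode_fps[OF c])
  ultimately have "eval_fps ?P2 z + eval_fps ?P1 z - eval_fps ?P0 z = 0"
    by (simp only: eval_fps_0)
  then show ?thesis
    unfolding P(1,3,5) by (simp add: algebra_simps)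
qed

section \<open>Uniqueness of the analytic solution at a regular singular point\<close>

lemma has_fps_expansion_eventually_0:
  fixes F :: "complex fps"
  assumes f: "f has_fps_expansion F" and "\<forall>\<^sub>F z in nhds 0. f z = 0"
  shows "F = 0"
proof (rule fps_ext)
  fix n
  have "fps_nth F n = (deriv ^^ n) f 0 / fact n"
    by (rule fps_nth_fps_expansion[OF f])
  also have "(deriv ^^ n) f 0 = (deriv ^^ n) (\<lambda>_. 0) 0"
    by (rule higher_deriv_cong_ev) (use assms in auto)
  finally show "F $ n = 0 $ n"
    by simp
qed

text \<open>Frobenius' method: if the coefficients of \<open>H\<close> vanish up to index m, the
  equation at index m reduces to (m + 1) (Q $ 0 + m) H $ (m + 1) = 0, and the first two factors are
  nonzero.\<close>

lemma fps_ode_zero: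
  fixes H P Q M :: "'a :: field_char_0 fps"
  assumes ode: "fps_X * P * fps_deriv (fps_deriv H) + Q * fps_deriv H + M * H = 0"
    and P: "P $ 0 = 1" and Q: "\<And>n. Q $ 0 + of_nat n \<noteq> 0" and H: "H $ 0 = 0"
  shows "H = 0"
proof (rule fps_ext)
  fix n
  show "H $ n = 0 $ n"
  proof (induction n rule: less_induct)
    case (less n)
    show ?case
    proof (cases n)
      case 0
      then show ?thesis
        using H by simp
    next
      case (Suc m)
      have H0: "H $ k = 0" if "k \<le> m" for k
        using less[of k] that Suc by simp
      \<comment> \<open>If \<open>B\<close> starts at index m or later, only the constant
        coefficient of \<open>A\<close> contributes to index m.\<close>
      have mult: "(A * B) $ m = A $ 0 * B $ m" if "\<And>k. k < m \<Longrightarrow> B $ k = 0" for A B :: "'a fps"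
      proof -
        have "(A * B) $ m = (\<Sum>i = 0..m. A $ i * B $ (m - i))"
          by (rule fps_mult_nth)
        also have "\<dots> = (\<Sum>i \<in> {0}. A $ i * B $ (m - i))"
          by (rule sum.mono_neutral_right) (use that in auto)
        finally show ?thesis
          by simp
      qed
      have M: "(M * H) $ m = 0"
        by (subst mult) (use H0 in auto)
      have Q': "(Q * fps_deriv H) $ m = Q $ 0 * of_nat (Suc m) * H $ Suc m"
        by (subst mult) (use H0 in auto)
      \<comment> \<open>The factor X is moved from the coefficient to H'': the product X H'' has no
        terms below index m, whereas H'' alone may have one at m - 1.\<close>
      have "(P * (fps_X * fps_deriv (fps_deriv H))) $ m =
          P $ 0 * (fps_X * fps_deriv (fps_deriv H)) $ m"
        by (rule mult) (use H0 in \<open>auto simp: Suc_leI\<close>)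
      also have "\<dots> = of_nat m * of_nat (Suc m) * H $ Suc m"
        using P by (cases m) auto
      finally have P': "(fps_X * P * fps_deriv (fps_deriv H)) $ m = \<dots>"
        by (simp add: mult_ac)
      have "of_nat (Suc m) * (Q $ 0 + of_nat m) * H $ Suc m = 0"
        using arg_cong[OF ode, of "\<lambda>F. F $ m"] unfolding fps_add_nth M Q' P'
        by (simp add: algebra_simps)
      then show ?thesis
        using Q[of m] Suc of_nat_neq_0[of m, where 'a = 'a] by (auto simp del: of_nat_Suc)
    qed
  qed
qed

text \<open>The origin is a regular singular point with exponents \<open>0\<close> and \<open>1 - q 0\<close>, so the analytic
  solution is determined by its value there as soon as \<open>1 - q 0\<close> is not a positive integer.\<close>

lemma singular_ode_unique:
  fixes f g p q m :: "complex \<Rightarrow> complex"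
  assumes S: "open S" "connected S" "0 \<in> S"
    and f: "\<And>z. z \<in> S \<Longrightarrow> (f has_field_derivative f1 z) (at z)"
      "\<And>z. z \<in> S \<Longrightarrow> (f1 has_field_derivative f2 z) (at z)"
      "\<And>z. z \<in> S \<Longrightarrow> z * p z * f2 z + q z * f1 z + m z * f z = 0"
    and g: "\<And>z. z \<in> S \<Longrightarrow> (g has_field_derivative g1 z) (at z)"
      "\<And>z. z \<in> S \<Longrightarrow> (g1 has_field_derivative g2 z) (at z)"
      "\<And>z. z \<in> S \<Longrightarrow> z * p z * g2 z + q z * g1 z + m z * g z = 0"
    and coeffs: "p holomorphic_on S" "q holomorphic_on S" "m holomorphic_on S"
    and p0: "p 0 = 1" and q0: "\<And>n. q 0 + of_nat n \<noteq> 0" and 0: "f 0 = g 0"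
    and z: "z \<in> S"
  shows "f z = g z"
proof -
  define h where "h z = f z - g z" for z
  define h1 where "h1 z = f1 z - g1 z" for z
  define h2 where "h2 z = f2 z - g2 z" for z
  have h: "(h has_field_derivative h1 z) (at z)" "(h1 has_field_derivative h2 z) (at z)"
    if "z \<in> S" for z
    unfolding h_def h1_def h2_def using f(1,2)[OF that] g(1,2)[OF that]
    by (auto intro!: derivative_eq_intros)
  have ode: "z * p z * h2 z + q z * h1 z + m z * h z = 0" if "z \<in> S" for z
    using f(3)[OF that] g(3)[OF that] unfolding h_def h1_def h2_def by algebra
  have hol: "h holomorphic_on S"
    using h S(1) holomorphic_on_open by blast
  have expansion: "u has_fps_expansion fps_expansion u 0" if "u holomorphic_on S" for u
    using that S by (metis analytic_at analytic_at_imp_has_fps_expansion_0)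
  \<comment> \<open>The equation for the difference becomes a formal equation for its Taylor series
    at 0; for this it suffices that it holds near 0.\<close>
  define H where "H = fps_expansion h 0"
  have S0: "\<forall>\<^sub>F z in nhds 0. z \<in> S"
    using S by (intro eventually_nhds_in_open)
  have H: "h has_fps_expansion H"
    unfolding H_def by (rule expansion[OF hol])
  have "h1 has_fps_expansion fps_deriv H"
    using has_fps_expansion_deriv[OF H]
  proof (rule has_fps_expansion_cong[THEN iffD1, rotated 2])
    show "\<forall>\<^sub>F z in nhds 0. deriv h z = h1 z"
      using S0 by eventually_elim (auto intro: DERIV_imp_deriv h)
  qed auto
  note H1 = this
  have "h2 has_fps_expansion fps_deriv (fps_deriv H)"
    using has_fps_expansion_deriv[OF H1]
  proof (rule has_fps_expansion_cong[THEN iffD1, rotated 2])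
    show "\<forall>\<^sub>F z in nhds 0. deriv h1 z = h2 z"
      using S0 by eventually_elim (auto intro: DERIV_imp_deriv h)
  qed auto
  note H2 = this
  let ?P = "fps_expansion p 0" and ?Q = "fps_expansion q 0" and ?M = "fps_expansion m 0"
  have "(\<lambda>z. z * p z * h2 z + q z * h1 z + m z * h z) has_fps_expansion
      fps_X * ?P * fps_deriv (fps_deriv H) + ?Q * fps_deriv H + ?M * H"
    by (intro fps_expansion_intros expansion coeffs H H1 H2)
  moreover have "\<forall>\<^sub>F z in nhds 0. z * p z * h2 z + q z * h1 z + m z * h z = 0"
    using S0 by eventually_elim (rule ode)
  ultimately have "fps_X * ?P * fps_deriv (fps_deriv H) + ?Q * fps_deriv H + ?M * H = 0"
    by (rule has_fps_expansion_eventually_0)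
  then have "H = 0"
    by (rule fps_ode_zero) (use p0 q0 0 in \<open>auto simp: fps_expansion_def H_def h_def\<close>)
  \<comment> \<open>The identity theorem carries the vanishing from the germ at 0 to all of the
    connected set \<open>S\<close>.\<close>
  then have "h z = 0"
    using has_fps_expansion_0_analytic_continuation[of h S z] H hol S z by simp
  then show ?thesis
    unfolding h_def by simp
qed

section \<open>Differential equations under a gauge factor and a substitution\<close>

lemma eval_fps_hypergeo_2F1_derivs:
  fixes a b c :: complex
  assumes "\<And>n. c + of_nat n \<noteq> 0" and z: "norm z < 1"
  defines "F \<equiv> fps_hypergeo [a, b] [c] 1"
  shows "(eval_fps F has_field_derivative eval_fps (fps_deriv F) z) (at z)"
    and "(eval_fps (fps_deriv F) has_field_derivative eval_fps (fps_deriv (fps_deriv F)) z) (at z)"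
proof -
  have "fps_conv_radius F \<ge> 1"
    unfolding F_def by (rule fps_conv_radius_hypergeo_2F1) fact
  then have F: "norm z < fps_conv_radius F"
    using z by (metis ereal_less(3) order_less_le_trans)
  moreover have "norm z < fps_conv_radius (fps_deriv F)"
    using F fps_conv_radius_deriv[of F] by (rule less_le_trans)
  ultimately show "(eval_fps F has_field_derivative eval_fps (fps_deriv F) z) (at z)"
    and "(eval_fps (fps_deriv F) has_field_derivative eval_fps (fps_deriv (fps_deriv F)) z) (at z)"
    by (auto intro: has_field_derivative_eval_fps)
qed

text \<open>Since \<open>u\<close> is the logarithmic derivative of the gauge factor
  \<open>P\<close>, every derivative is again \<open>P\<close> times an expression in which
  \<open>P\<close> no longer occurs. A linear equation for the product can thus be checked by
  rational algebra alone.\<close>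

lemma gauge_compose_derivs:
  fixes P u \<phi> \<phi>1 G G1 :: "'a :: real_normed_field \<Rightarrow> 'a"
  assumes P: "(P has_field_derivative P s * u s) (at s)"
    and u: "(u has_field_derivative u1) (at s)"
    and \<phi>: "(\<phi> has_field_derivative \<phi>1 s) (at s)"
    and \<phi>1: "(\<phi>1 has_field_derivative \<phi>2) (at s)"
    and G: "(G has_field_derivative G1 (\<phi> s)) (at (\<phi> s))"
    and G1: "(G1 has_field_derivative G2) (at (\<phi> s))"
  shows "((\<lambda>s. P s * G (\<phi> s)) has_field_derivative
      P s * (u s * G (\<phi> s) + \<phi>1 s * G1 (\<phi> s))) (at s)"
    and "((\<lambda>s. P s * (u s * G (\<phi> s) + \<phi>1 s * G1 (\<phi> s))) has_field_derivative
      P s * (((u s)\<^sup>2 + u1) * G (\<phi> s) + (2 * u s * \<phi>1 s + \<phi>2) * G1 (\<phi> s) + (\<phi>1 s)\<^sup>2 * G2)) (at s)"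
proof -
  note D = P u \<phi>1 DERIV_chain2[OF G \<phi>] DERIV_chain2[OF G1 \<phi>]
  show "((\<lambda>s. P s * G (\<phi> s)) has_field_derivative
      P s * (u s * G (\<phi> s) + \<phi>1 s * G1 (\<phi> s))) (at s)"
    by (rule derivative_eq_intros D refl)+ (simp add: algebra_simps)
  show "((\<lambda>s. P s * (u s * G (\<phi> s) + \<phi>1 s * G1 (\<phi> s))) has_field_derivative
      P s * (((u s)\<^sup>2 + u1) * G (\<phi> s) + (2 * u s * \<phi>1 s + \<phi>2) * G1 (\<phi> s) + (\<phi>1 s)\<^sup>2 * G2)) (at s)"
    by (rule derivative_eq_intros D refl)+ (simp add: algebra_simps power2_eq_square)
qed

text \<open>With w = 1 - s, and \<open>E0\<close>, \<open>E1\<close>, \<open>E2\<close> for the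
  values of G, G', G'' at s / (s - 1) = (w - 1) / w, the left side is the operator with parameters
  a, b, c applied to w^(-a) G(s / (s - 1)), the gauge divided out. It is a multiple of the operator
  with parameters a, c - b, c applied to G.\<close>

lemma pfaff_ode_transform:
  fixes w :: "'a :: field"
  assumes "w \<noteq> 0"
  shows "(1 - w) * w * (((a / w)\<^sup>2 + a / w\<^sup>2) * E0 +
      (2 * (a / w) * (- 1 / w\<^sup>2) - 2 / w ^ 3) * E1 + (- 1 / w\<^sup>2)\<^sup>2 * E2) +
    (c - (a + b + 1) * (1 - w)) * (a / w * E0 + - 1 / w\<^sup>2 * E1) + - (a * b) * E0 =
    - 1 / w * ((w - 1) / w * (1 - (w - 1) / w) * E2 +
      (c - (a + (c - b) + 1) * ((w - 1) / w)) * E1 - a * (c - b) * E0)"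
  using assms by (simp add: divide_simps) algebra

text \<open>The analogue for the gauge w^(-2 a) with w = 1 + r and the substitution 4 r / w^2: the
  equation in r is a multiple of the hypergeometric one with parameters a, b, 2 b.\<close>

lemma quadratic_ode_transform:
  fixes w :: "'a :: field"
  assumes "w \<noteq> 0" and r: "r = w - 1"
  shows "r * (1 - r\<^sup>2) * (((- 2 * a / w)\<^sup>2 + 2 * a / w\<^sup>2) * E0 +
      (2 * (- 2 * a / w) * (4 * (1 - r) / w ^ 3) + - 8 * (2 - r) / w ^ 4) * E1 +
      (4 * (1 - r) / w ^ 3)\<^sup>2 * E2) +
    (2 * b - (4 * a - 2 * b + 2) * r\<^sup>2) * (- 2 * a / w * E0 + 4 * (1 - r) / w ^ 3 * E1) +
    - 2 * a * (2 * a - 2 * b + 1) * r * E0 =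
    4 * (1 - r) / w * (4 * r / w\<^sup>2 * (1 - 4 * r / w\<^sup>2) * E2 +
      (2 * b - (a + b + 1) * (4 * r / w\<^sup>2)) * E1 - a * b * E0)"
  using assms(1) unfolding r by (simp add: divide_simps) algebra

section \<open>Pfaff's and Gauss' transformations of the series\<close>

text \<open>The half-plane consists of the points that are closer to 0 than to 1.\<close>

lemma norm_pfaff_lt_1:
  fixes s :: complex
  assumes "Re s < 1 / 2"
  shows "norm (s / (s - 1)) < 1"
proof -
  have "(norm s)\<^sup>2 < (norm (s - 1))\<^sup>2"
    using assms unfolding cmod_power2 by (simp add: power2_eq_square algebra_simps)
  then have "norm s < norm (s - 1)"
    using power2_less_imp_less norm_ge_zero by blast
  moreover from this have "0 < norm (s - 1)"
    by (rule le_less_trans[OF norm_ge_zero])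
  ultimately show ?thesis
    by (simp add: norm_divide)
qed

lemma not_nonpos_Reals_if_Re_pos: "Re z > 0 \<Longrightarrow> z \<notin> \<real>\<^sub>\<le>\<^sub>0"
  by (auto simp: complex_nonpos_Reals_iff)

text \<open>Both sides solve the hypergeometric equation with parameters a, b, c and equal 1 at the
  origin. The disc meets the half-plane in a convex set, so \<open>singular_ode_unique\<close>
  applies.\<close>

lemma hypergeo_2F1_pfaff:
  fixes a b c :: complex
  assumes c: "\<And>n. c + of_nat n \<noteq> 0" and s: "norm s < 1" "Re s < 1 / 2"
  shows "eval_fps (fps_hypergeo [a, b] [c] 1) s =
    (1 - s) powr (- a) * eval_fps (fps_hypergeo [a, c - b] [c] 1) (s / (s - 1))"
proof -
  let ?S = "ball 0 1 \<inter> {s. Re s < 1 / 2}"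
  define F where "F = fps_hypergeo [a, b] [c] 1"
  define G where "G = fps_hypergeo [a, c - b] [c] 1"
  define P where "P s = (1 - s) powr (- a)" for s
  define u where "u s = a / (1 - s)" for s
  define \<phi> where "\<phi> s = s / (s - 1)" for s :: complex
  define \<phi>1 where "\<phi>1 s = - 1 / (1 - s)\<^sup>2" for s :: complex
  define g1 where "g1 s = P s * (u s * eval_fps G (\<phi> s) + \<phi>1 s * eval_fps (fps_deriv G) (\<phi> s))" for s
  define g2 where "g2 s = P s * (((u s)\<^sup>2 + a / (1 - s)\<^sup>2) * eval_fps G (\<phi> s) +
    (2 * u s * \<phi>1 s - 2 / (1 - s) ^ 3) * eval_fps (fps_deriv G) (\<phi> s) +
    (\<phi>1 s)\<^sup>2 * eval_fps (fps_deriv (fps_deriv G)) (\<phi> s))" for s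
  have derivs: "((\<lambda>s. P s * eval_fps G (\<phi> s)) has_field_derivative g1 s) (at s)"
    "(g1 has_field_derivative g2 s) (at s)" if "Re s < 1 / 2" for s
  proof -
    have nz: "1 - s \<noteq> 0" "s - 1 \<noteq> 0" and nonpos: "1 - s \<notin> \<real>\<^sub>\<le>\<^sub>0"
      using that by (auto simp: not_nonpos_Reals_if_Re_pos)
    have P': "(P has_field_derivative P s * u s) (at s)"
      unfolding P_def u_def using nonpos nz
      by (auto intro!: derivative_eq_intros simp: powr_diff field_simps)
    have u': "(u has_field_derivative a / (1 - s)\<^sup>2) (at s)"
      unfolding u_def using nz by (auto intro!: derivative_eq_intros simp: power2_eq_square)
    have \<phi>': "(\<phi> has_field_derivative \<phi>1 s) (at s)"
      unfolding \<phi>_def \<phi>1_def using nz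
      by (auto intro!: derivative_eq_intros simp: divide_simps) (auto simp: algebra_simps power2_eq_square)
    have \<phi>1': "(\<phi>1 has_field_derivative - 2 / (1 - s) ^ 3) (at s)"
      unfolding \<phi>1_def using nz
      by (auto intro!: derivative_eq_intros simp: divide_simps) (auto simp: eval_nat_numeral)
    have \<phi>: "norm (\<phi> s) < 1"
      unfolding \<phi>_def using that by (rule norm_pfaff_lt_1)
    note D = gauge_compose_derivs[where G = "eval_fps G", OF P' u' \<phi>' \<phi>1'
        eval_fps_hypergeo_2F1_derivs[OF c \<phi>, of a "c - b", folded G_def]]
    show "((\<lambda>s. P s * eval_fps G (\<phi> s)) has_field_derivative g1 s) (at s)"
      unfolding g1_def by (rule D)
    show "(g1 has_field_derivative g2 s) (at s)"
      using D(2) unfolding g1_def[abs_def] g2_def by simp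
  qed
  have "eval_fps F s = P s * eval_fps G (\<phi> s)"
  proof (rule singular_ode_unique[where f = "eval_fps F" and g = "\<lambda>s. P s * eval_fps G (\<phi> s)"
        and ?f1.0 = "eval_fps (fps_deriv F)"
        and ?f2.0 = "eval_fps (fps_deriv (fps_deriv F))" and ?g1.0 = g1 and ?g2.0 = g2 and S = ?S
        and p = "\<lambda>s. 1 - s" and q = "\<lambda>s. c - (a + b + 1) * s" and m = "\<lambda>_. - (a * b)"])
    show "open ?S"
      by (intro open_Int open_ball open_Collect_less continuous_intros)
    have "convex ?S"
      by (intro convex_Int convex_ball convex_halfspace_Re_lt)
    then show "connected ?S"
      by (rule convex_connected)
    show "s * (1 - s) * g2 s + (c - (a + b + 1) * s) * g1 s + - (a * b) * (P s * eval_fps G (\<phi> s)) = 0"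
      if "s \<in> ?S" for s
    proof -
      define w where "w = 1 - s"
      have w: "w \<noteq> 0" "s = 1 - w"
        using that by (auto simp: w_def)
      have \<phi>: "\<phi> s = (w - 1) / w"
        using w by (simp add: \<phi>_def divide_simps)
      have "norm (\<phi> s) < 1"
        unfolding \<phi>_def by (rule norm_pfaff_lt_1) (use that in auto)
      \<comment> \<open>The equation for \<open>G\<close> is multiplied by the gauge and by -1 / w,
        the factor occurring in \<open>pfaff_ode_transform\<close>.\<close>
      from hypergeo_2F1_ode[OF c this, of a "c - b", folded G_def]
      have "P s * (- 1 / w * (\<phi> s * (1 - \<phi> s) * eval_fps (fps_deriv (fps_deriv G)) (\<phi> s) +
          (c - (a + (c - b) + 1) * \<phi> s) * eval_fps (fps_deriv G) (\<phi> s) -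
          a * (c - b) * eval_fps G (\<phi> s))) = 0"
        by simp
      then have "P s * (s * (1 - s) * (((a / w)\<^sup>2 + a / w\<^sup>2) * eval_fps G (\<phi> s) +
          (2 * (a / w) * (- 1 / w\<^sup>2) - 2 / w ^ 3) * eval_fps (fps_deriv G) (\<phi> s) +
          (- 1 / w\<^sup>2)\<^sup>2 * eval_fps (fps_deriv (fps_deriv G)) (\<phi> s)) +
          (c - (a + b + 1) * s) * (a / w * eval_fps G (\<phi> s) +
            - 1 / w\<^sup>2 * eval_fps (fps_deriv G) (\<phi> s)) + - (a * b) * eval_fps G (\<phi> s)) = 0"
        using pfaff_ode_transform[OF w(1), of a "eval_fps G (\<phi> s)" "eval_fps (fps_deriv G) (\<phi> s)"
          "eval_fps (fps_deriv (fps_deriv G)) (\<phi> s)" c b]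
        by (simp only: \<phi>[symmetric] w(2)[symmetric] w_def[symmetric])
      then show ?thesis
        unfolding g1_def g2_def u_def \<phi>1_def w_def by (simp only: ring_distribs mult_ac)
    qed
    show "s * (1 - s) * eval_fps (fps_deriv (fps_deriv F)) s +
        (c - (a + b + 1) * s) * eval_fps (fps_deriv F) s + - (a * b) * eval_fps F s = 0"
      if "s \<in> ?S" for s
      using hypergeo_2F1_ode[OF c, of s a b] that unfolding F_def by simp
    show "eval_fps F 0 = P 0 * eval_fps G (\<phi> 0)"
      by (simp add: F_def G_def P_def \<phi>_def eval_fps_at_0)
  qed (use s c derivs eval_fps_hypergeo_2F1_derivs[OF c, of _ a b] in
      \<open>auto intro!: holomorphic_intros simp: F_def\<close>)
  then show ?thesis
    unfolding F_def G_def P_def \<phi>_def .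
qed

text \<open>After division by \<open>(1 + r) powr (2 * a)\<close> both sides solve
  \<open>r (1 - r\<^sup>2) y'' + (2 b - (4 a - 2 b + 2) r\<^sup>2) y' - 2 a (2 a - 2 b + 1) r y = 0\<close>.\<close>

lemma hypergeo_2F1_quadratic:
  fixes a b r :: complex
  assumes b: "\<And>n. 2 * b + of_nat n \<noteq> 0" and r: "norm r < 1" "4 * norm r < (norm (1 + r))\<^sup>2"
  shows "eval_fps (fps_hypergeo [a, b] [2 * b] 1) (4 * r / (1 + r)\<^sup>2) =
    (1 + r) powr (2 * a) * eval_fps (fps_hypergeo [a, a - b + 1 / 2] [b + 1 / 2] 1) (r\<^sup>2)"
proof -
  \<comment> \<open>The conditions place r^2 and 4 r / (1 + r)^2 in the unit disc; the second is
    written without division.\<close>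
  let ?S = "{r. norm r < 1 \<and> 4 * norm r < (norm (1 + r))\<^sup>2} :: complex set"
  have c: "b + 1 / 2 + of_nat n \<noteq> 0" for n
  proof
    assume "b + 1 / 2 + of_nat n = 0"
    then have "2 * (b + 1 / 2 + of_nat n) = 0"
      by simp
    then have "2 * b + of_nat (2 * n + 1) = 0"
      by (simp add: algebra_simps)
    then show False
      using b by blast
  qed
  define F where "F = fps_hypergeo [a, b] [2 * b] 1"
  define G where "G = fps_hypergeo [a, a - b + 1 / 2] [b + 1 / 2] 1"
  define P where "P r = (1 + r) powr (- 2 * a)" for r
  define u where "u r = - 2 * a / (1 + r)" for r
  define \<phi> where "\<phi> r = 4 * r / (1 + r)\<^sup>2" for r :: complex
  define \<phi>1 where "\<phi>1 r = 4 * (1 - r) / (1 + r) ^ 3" for r :: complex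
  define f1 where "f1 r = P r * (u r * eval_fps F (\<phi> r) + \<phi>1 r * eval_fps (fps_deriv F) (\<phi> r))" for r
  define f2 where "f2 r = P r * (((u r)\<^sup>2 + 2 * a / (1 + r)\<^sup>2) * eval_fps F (\<phi> r) +
    (2 * u r * \<phi>1 r + - 8 * (2 - r) / (1 + r) ^ 4) * eval_fps (fps_deriv F) (\<phi> r) +
    (\<phi>1 r)\<^sup>2 * eval_fps (fps_deriv (fps_deriv F)) (\<phi> r))" for r
  define g1 where "g1 r = 2 * r * eval_fps (fps_deriv G) (r\<^sup>2)" for r
  define g2 where "g2 r = 2 * eval_fps (fps_deriv G) (r\<^sup>2) +
    (2 * r)\<^sup>2 * eval_fps (fps_deriv (fps_deriv G)) (r\<^sup>2)" for r
  have S: "1 + r \<noteq> 0" "norm (\<phi> r) < 1" "norm (r\<^sup>2) < 1" "1 + r \<notin> \<real>\<^sub>\<le>\<^sub>0" if "r \<in> ?S" for r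
  proof -
    show *: "1 + r \<noteq> 0"
      using that by auto
    show "norm (\<phi> r) < 1"
      using that * unfolding \<phi>_def by (simp add: norm_divide norm_mult norm_power)
    show "norm (r\<^sup>2) < 1"
      using that by (simp add: norm_power power_less_one_iff)
    show "1 + r \<notin> \<real>\<^sub>\<le>\<^sub>0"
      using that abs_Re_le_cmod[of r] by (intro not_nonpos_Reals_if_Re_pos) auto
  qed
  have f_derivs: "((\<lambda>r. P r * eval_fps F (\<phi> r)) has_field_derivative f1 r) (at r)"
    "(f1 has_field_derivative f2 r) (at r)" if "r \<in> ?S" for r
  proof -
    have nz: "1 + r \<noteq> 0"
      using S[OF that] by auto
    have P': "(P has_field_derivative P r * u r) (at r)"
      unfolding P_def u_def using S[OF that]
      by (auto intro!: derivative_eq_intros simp: powr_diff field_simps)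
    have u': "(u has_field_derivative 2 * a / (1 + r)\<^sup>2) (at r)"
      unfolding u_def using nz by (auto intro!: derivative_eq_intros simp: power2_eq_square)
    have \<phi>': "(\<phi> has_field_derivative \<phi>1 r) (at r)"
      unfolding \<phi>_def \<phi>1_def using nz
      by (auto intro!: derivative_eq_intros simp: divide_simps) (auto simp: algebra_simps eval_nat_numeral)
    have \<phi>1': "(\<phi>1 has_field_derivative - 8 * (2 - r) / (1 + r) ^ 4) (at r)"
      unfolding \<phi>1_def using nz
      by (auto intro!: derivative_eq_intros simp: divide_simps) (auto simp: algebra_simps eval_nat_numeral)
    note D = gauge_compose_derivs[where G = "eval_fps F", OF P' u' \<phi>' \<phi>1'
        eval_fps_hypergeo_2F1_derivs[OF b S(2)[OF that], of a b, folded F_def]]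
    show "((\<lambda>r. P r * eval_fps F (\<phi> r)) has_field_derivative f1 r) (at r)"
      unfolding f1_def by (rule D)
    show "(f1 has_field_derivative f2 r) (at r)"
      using D(2) unfolding f1_def[abs_def] f2_def by simp
  qed
  have g_derivs: "((\<lambda>r. eval_fps G (r\<^sup>2)) has_field_derivative g1 r) (at r)"
    "(g1 has_field_derivative g2 r) (at r)" if "r \<in> ?S" for r
  proof -
    \<comment> \<open>Here the gauge is the constant 1, with logarithmic derivative 0, and the
      substitution is squaring.\<close>
    have "((\<lambda>_. 1) has_field_derivative 1 * 0) (at r)" "((\<lambda>_. 0) has_field_derivative 0) (at r)"
      "((\<lambda>r. r\<^sup>2) has_field_derivative 2 * r) (at r)" "((\<lambda>r. 2 * r) has_field_derivative 2) (at r)"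
      by (auto intro!: derivative_eq_intros)
    note D = gauge_compose_derivs[where G = "eval_fps G", OF this
        eval_fps_hypergeo_2F1_derivs[OF c S(3)[OF that], of a "a - b + 1 / 2", folded G_def]]
    show "((\<lambda>r. eval_fps G (r\<^sup>2)) has_field_derivative g1 r) (at r)"
      using D(1) unfolding g1_def by simp
    show "(g1 has_field_derivative g2 r) (at r)"
      using D(2) unfolding g1_def[abs_def] g2_def by (simp add: power2_eq_square)
  qed
  have "P r * eval_fps F (\<phi> r) = eval_fps G (r\<^sup>2)"
  proof (rule singular_ode_unique[where f = "\<lambda>r. P r * eval_fps F (\<phi> r)"
        and g = "\<lambda>r. eval_fps G (r\<^sup>2)" and z = r and ?f1.0 = f1 and ?f2.0 = f2 and ?g1.0 = g1 and ?g2.0 = g2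
        and S = ?S and p = "\<lambda>r. 1 - r\<^sup>2" and q = "\<lambda>r. 2 * b - (4 * a - 2 * b + 2) * r\<^sup>2"
        and m = "\<lambda>r. - 2 * a * (2 * a - 2 * b + 1) * r"])
    have "?S = {r. norm r < 1} \<inter> {r. 4 * norm r < (norm (1 + r))\<^sup>2}"
      by auto
    moreover have "open \<dots>"
      by (intro open_Int open_Collect_less continuous_intros)
    ultimately show "open ?S"
      by simp
    have "closed_segment 0 r \<subseteq> ?S" if "r \<in> ?S" for r
    proof
      fix z assume "z \<in> closed_segment 0 r"
      then obtain k where k: "0 \<le> k" "k \<le> 1" and z: "z = of_real k * r"
        by (auto simp: in_segment scaleR_conv_of_real)
      have norm: "(norm (1 + of_real k * r))\<^sup>2 = 1 + 2 * k * Re r + k\<^sup>2 * (norm r)\<^sup>2" for k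
        unfolding cmod_power2 by (simp add: power2_eq_square algebra_simps)
      have "k * norm r < 1"
        using that k by (metis (no_types, lifting) mem_Collect_eq mult_left_le_one_le norm_ge_zero order_le_less_trans)
      have "4 * (k * norm r) < (norm (1 + of_real k * r))\<^sup>2"
      proof (cases "k = 0")
        case False
        \<comment> \<open>Multiplying the condition at r by k > 0 leaves a difference of (1 - k) (1
          - k |r|^2), which has to be nonnegative.\<close>
        have "k * (norm r)\<^sup>2 \<le> 1"
          using k that by (intro mult_le_one) (auto simp: power_le_one)
        then have "0 \<le> (1 - k) * (1 - k * (norm r)\<^sup>2)"
          using k by simp
        moreover have "k * (4 * norm r) < k * (1 + 2 * Re r + (norm r)\<^sup>2)"
          using that norm[of 1] k False by simp
        ultimately show ?thesis
          unfolding norm by (simp add: algebra_simps power2_eq_square)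
      qed simp
      with \<open>k * norm r < 1\<close> show "z \<in> ?S"
        using k by (simp add: z norm_mult)
    qed
    then have "starlike ?S"
      unfolding starlike_def by (intro bexI[of _ 0]) auto
    then show "connected ?S"
      by (rule starlike_imp_connected)
    show "r * (1 - r\<^sup>2) * f2 r + (2 * b - (4 * a - 2 * b + 2) * r\<^sup>2) * f1 r +
        - 2 * a * (2 * a - 2 * b + 1) * r * (P r * eval_fps F (\<phi> r)) = 0" if "r \<in> ?S" for r
    proof -
      define w where "w = 1 + r"
      have w: "w \<noteq> 0" "r = w - 1"
        using S[OF that] by (auto simp: w_def)
      have \<phi>: "4 * r / w\<^sup>2 = \<phi> r"
        by (simp add: \<phi>_def w_def)
      let ?F0 = "eval_fps F (\<phi> r)" and ?F1 = "eval_fps (fps_deriv F) (\<phi> r)"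
        and ?F2 = "eval_fps (fps_deriv (fps_deriv F)) (\<phi> r)"
      have "\<phi> r * (1 - \<phi> r) * ?F2 + (2 * b - (a + b + 1) * \<phi> r) * ?F1 - a * b * ?F0 = 0"
        using hypergeo_2F1_ode[OF b S(2)[OF that], of a b, folded F_def] .
      from quadratic_ode_transform[OF w, of a ?F0 ?F1 ?F2 b, unfolded \<phi> this]
      have "P r * (r * (1 - r\<^sup>2) * (((u r)\<^sup>2 + 2 * a / w\<^sup>2) * ?F0 +
          (2 * u r * \<phi>1 r + - 8 * (2 - r) / w ^ 4) * ?F1 + (\<phi>1 r)\<^sup>2 * ?F2) +
          (2 * b - (4 * a - 2 * b + 2) * r\<^sup>2) * (u r * ?F0 + \<phi>1 r * ?F1) +
          - 2 * a * (2 * a - 2 * b + 1) * r * ?F0) = 0"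
        unfolding u_def \<phi>1_def w_def[symmetric] by simp
      then show ?thesis
        unfolding f1_def f2_def w_def by (simp only: ring_distribs mult_ac)
    qed
    show "r * (1 - r\<^sup>2) * g2 r + (2 * b - (4 * a - 2 * b + 2) * r\<^sup>2) * g1 r +
        - 2 * a * (2 * a - 2 * b + 1) * r * eval_fps G (r\<^sup>2) = 0" if "r \<in> ?S" for r
    proof -
      let ?G0 = "eval_fps G (r\<^sup>2)" and ?G1 = "eval_fps (fps_deriv G) (r\<^sup>2)"
        and ?G2 = "eval_fps (fps_deriv (fps_deriv G)) (r\<^sup>2)"
      \<comment> \<open>In the variable r^2 the equation is 4 r times the hypergeometric one with
        parameters a, a - b + 1/2, b + 1/2.\<close>
      have "r * (1 - r\<^sup>2) * g2 r + (2 * b - (4 * a - 2 * b + 2) * r\<^sup>2) * g1 r +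
          - 2 * a * (2 * a - 2 * b + 1) * r * ?G0 =
          4 * r * (r\<^sup>2 * (1 - r\<^sup>2) * ?G2 +
            (b + 1 / 2 - (a + (a - b + 1 / 2) + 1) * r\<^sup>2) * ?G1 - a * (a - b + 1 / 2) * ?G0)"
        unfolding g1_def g2_def by (simp add: algebra_simps power2_eq_square)
      then show ?thesis
        using hypergeo_2F1_ode[OF c S(3)[OF that], of a "a - b + 1 / 2", folded G_def] by simp
    qed
    show "P 0 * eval_fps F (\<phi> 0) = eval_fps G (0\<^sup>2)"
      by (simp add: F_def G_def P_def \<phi>_def eval_fps_at_0)
  qed (use r b f_derivs g_derivs in \<open>auto intro!: holomorphic_intros\<close>)
  then have "(1 + r) powr (2 * a) * (P r * eval_fps F (\<phi> r)) = (1 + r) powr (2 * a) * eval_fps G (r\<^sup>2)"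
    by simp
  moreover have "(1 + r) powr (2 * a) * P r = 1"
    using S(1)[of r] r unfolding P_def by (simp add: powr_minus)
  ultimately show ?thesis
    unfolding F_def G_def \<phi>_def by (simp add: mult.assoc[symmetric])
qed

section \<open>The Gauss function on the disc and on a half-plane\<close>

lemma fps_hypergeo_2F1_commute: "fps_hypergeo [a, b] [c] z = fps_hypergeo [b, a] [c] z"
  by (simp add: fps_eq_iff)

lemma gauss_2F1_commute: "gauss_2F1 a b c z = gauss_2F1 b a c z"
  unfolding gauss_2F1_def gauss_continuation_def fps_hypergeo_2F1_commute[of a b] ..

lemma gauss_2F1_disc:
  fixes a b c z :: complex
  assumes "\<And>n. c + of_nat n \<noteq> 0" and z: "norm z < 1"
  shows "gauss_2F1 a b c z = eval_fps (fps_hypergeo [a, b] [c] 1) z"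
proof (rule gauss_2F1_eqI[where S = "ball 0 1"])
  have "eval_fps (fps_hypergeo [a, b] [c] 1) holomorphic_on ball 0 1"
    by (rule holomorphic_on_hypergeo_2F1) fact
  moreover have "closed_segment 0 s \<subseteq> ball 0 1" if "s \<in> ball 0 1" for s :: complex
    using that by (intro closed_segment_subset) auto
  ultimately show "gauss_continuation a b c (ball 0 1) (eval_fps (fps_hypergeo [a, b] [c] 1))"
    unfolding gauss_continuation_def by blast
qed (use z in auto)

text \<open>The right side is holomorphic on the whole half-plane, which is convex and contains 0,
  and by \<open>hypergeo_2F1_pfaff\<close> it agrees with the series inside the disc. It is
  therefore a witness for the continuation.\<close>

lemma gauss_2F1_pfaff:
  fixes a b c z :: complex
  assumes c: "\<And>n. c + of_nat n \<noteq> 0" and z: "Re z < 1 / 2"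
  shows "gauss_2F1 a b c z =
    (1 - z) powr (- a) * eval_fps (fps_hypergeo [a, c - b] [c] 1) (z / (z - 1))"
proof (rule gauss_2F1_eqI[where S = "{s. Re s < 1 / 2}"])
  let ?S = "{s. Re s < 1 / 2}" and ?G = "eval_fps (fps_hypergeo [a, c - b] [c] 1)"
  have "?G holomorphic_on ball 0 1"
    by (rule holomorphic_on_hypergeo_2F1) fact
  moreover have "(\<lambda>s. s / (s - 1)) holomorphic_on ?S"
    by (auto intro!: holomorphic_intros)
  moreover have "(\<lambda>s. s / (s - 1)) ` ?S \<subseteq> ball 0 1"
    using norm_pfaff_lt_1 by auto
  ultimately have "(?G \<circ> (\<lambda>s. s / (s - 1))) holomorphic_on ?S"
    by (intro holomorphic_on_compose_gen)
  then have "(\<lambda>s. ?G (s / (s - 1))) holomorphic_on ?S"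
    by (simp add: o_def)
  moreover have "(\<lambda>s. (1 - s) powr (- a)) holomorphic_on ?S"
    by (intro holomorphic_intros) (auto simp: not_nonpos_Reals_if_Re_pos)
  ultimately have "(\<lambda>s. (1 - s) powr (- a) * ?G (s / (s - 1))) holomorphic_on ?S"
    by (intro holomorphic_on_mult)
  moreover have "open ?S"
    by (rule open_halfspace_Re_lt)
  moreover have "closed_segment 0 s \<subseteq> ?S" if "s \<in> ?S" for s
    using that by (intro closed_segment_subset convex_halfspace_Re_lt) auto
  ultimately show "gauss_continuation a b c ?S (\<lambda>s. (1 - s) powr (- a) * ?G (s / (s - 1)))"
    unfolding gauss_continuation_def using hypergeo_2F1_pfaff[OF c, of _ a b] by auto
qed (use z in auto)

section \<open>Equality of the Bessel and Legendre kernels\<close>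

text \<open>All bases are built from 2, x, y, y - x and x + y, so taking logarithms leaves an
  identity linear in theirs. The last factors on the two sides come from the quadratic and from
  Pfaff's transformation.\<close>

lemma kernel_powr_identity:
  fixes x y \<alpha> \<nu> :: real
  assumes "0 < x" "x < y"
  shows "((y\<^sup>2 - x\<^sup>2) / (2 * y)) powr (2 * \<alpha> - 1) * (2 * y / (x + y)) powr (2 * \<alpha> + \<nu> - 1) =
    (y\<^sup>2 - x\<^sup>2) powr (\<alpha> - 1 / 2) * (y / x) powr (\<nu> / 2) *
    (((x + y) / (y - x))\<^sup>2) powr ((1 / 2 - \<alpha>) / 2) *
    ((x + y)\<^sup>2 / (4 * x * y)) powr (- \<nu> / 2)"
proof -
  have pos: "y - x > 0" "x + y > 0" "y > 0"
    using assms by auto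
  have eq: "y\<^sup>2 - x\<^sup>2 = (y - x) * (x + y)"
    by (simp add: power2_eq_square algebra_simps)
  have "y\<^sup>2 - x\<^sup>2 > 0"
    unfolding eq using pos by simp
  moreover have "ln (y\<^sup>2 - x\<^sup>2) = ln (y - x) + ln (x + y)"
    unfolding eq using pos by (simp add: ln_mult)
  moreover have "ln 4 = 2 * ln (2 :: real)"
    using ln_realpow[of 2 2] by simp
  ultimately show ?thesis
    using assms pos
    by (simp add: powr_def exp_add[symmetric] ln_mult ln_div ln_realpow) (simp add: field_simps)
qed

text \<open>Each Gauss function becomes a real power times \<open>eval_fps G\<close> at r^2, so that
  only real prefactors remain to be compared.\<close>

lemma bessel_kernel_eq_legendre:
  fixes x y \<alpha> \<nu> :: real
  assumes \<alpha>: "\<alpha> > 0" and x: "0 < x" "x < y"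
  shows "of_real (((y\<^sup>2 - x\<^sup>2) / (2 * y)) powr (2 * \<alpha> - 1)) *
      gauss_2F1 (of_real (\<alpha> + (\<nu> - 1) / 2)) (of_real \<alpha>) (of_real (2 * \<alpha>)) (of_real (1 - x\<^sup>2 / y\<^sup>2)) =
    of_real (Gamma (\<alpha> + 1 / 2) * ((y\<^sup>2 - x\<^sup>2) powr (\<alpha> - 1 / 2) * (y / x) powr (\<nu> / 2))) *
      legendre_P (\<nu> / 2 - 1) (1 / 2 - \<alpha>) (1 / 2 * (x / y + y / x))"
proof -
  define r where "r = (y - x) / (x + y)"
  define z where "z = - (y - x)\<^sup>2 / (4 * x * y)"
  define a where "a = \<alpha> + (\<nu> - 1) / 2"
  \<comment> \<open>With b = \<alpha>, the parameters a - b + 1/2 and b + 1/2 of the quadratic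
    transformation are \<nu> / 2 and \<alpha> + 1/2.\<close>
  define G where "G = fps_hypergeo [complex_of_real a, of_real (\<nu> / 2)] [of_real (\<alpha> + 1 / 2)] 1"
  define w where "w = 1 / 2 * (x / y + y / x)"
  have y: "y > 0" "x + y > 0" "y - x > 0"
    using x by auto
  have r: "0 < r" "r < 1" "1 + r = 2 * y / (x + y)"
    using x y by (auto simp: r_def field_simps)
  have nonpole: "complex_of_real c + of_nat n \<noteq> 0" if "c > 0" for c n
  proof -
    have "c + real n \<noteq> 0"
      using that by simp
    then show ?thesis
      by (metis of_real_add of_real_eq_0_iff of_real_of_nat_eq)
  qed
  have arg: "1 - x\<^sup>2 / y\<^sup>2 = 4 * r / (1 + r)\<^sup>2"
  proof -
    have cancel: "4 * (p / s) / (2 * y / s)\<^sup>2 = p * s / y\<^sup>2" if "s \<noteq> 0" for p s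
      using that y by (simp add: field_simps power2_eq_square)
    have "4 * r / (1 + r)\<^sup>2 = (y - x) * (x + y) / y\<^sup>2"
      unfolding r(3) unfolding r_def by (rule cancel) (use y in simp)
    then show ?thesis
      using y by (simp add: field_simps power2_eq_square)
  qed
  \<comment> \<open>That the argument lies strictly between 0 and 1 gives both the convergence of
    the series and the domain condition of the quadratic transformation.\<close>
  have "0 < x\<^sup>2 / y\<^sup>2" "x\<^sup>2 / y\<^sup>2 < 1"
    using x y by (auto simp: power_strict_mono)
  then have arg_lt: "0 < 4 * r / (1 + r)\<^sup>2" "4 * r / (1 + r)\<^sup>2 < 1"
    using arg by auto
  moreover have "0 < (1 + r)\<^sup>2"
    using r(1) by simp
  ultimately have "4 * r < (1 + r)\<^sup>2"
    by (simp only: pos_divide_less_eq mult_1)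
  then have quad: "4 * norm (complex_of_real r) < (norm (1 + complex_of_real r))\<^sup>2"
    using r(1) by (metis abs_of_pos add_pos_pos norm_of_real of_real_1 of_real_add zero_less_one)
  have "gauss_2F1 (of_real a) (of_real \<alpha>) (of_real (2 * \<alpha>)) (of_real (1 - x\<^sup>2 / y\<^sup>2)) =
      eval_fps (fps_hypergeo [of_real a, of_real \<alpha>] [of_real (2 * \<alpha>)] 1) (of_real (1 - x\<^sup>2 / y\<^sup>2))"
    using \<alpha> arg_lt unfolding arg by (intro gauss_2F1_disc nonpole) (simp_all only: norm_of_real)
  also have "\<dots> = (1 + of_real r) powr (2 * of_real a) * eval_fps G ((of_real r)\<^sup>2)"
  proof -
    have "complex_of_real a - of_real \<alpha> + 1 / 2 = of_real (\<nu> / 2)"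
      by (simp add: a_def field_simps)
    moreover have "2 * complex_of_real \<alpha> + of_nat n \<noteq> 0" for n
      using nonpole[of "2 * \<alpha>" n] \<alpha> by simp
    note quadratic = hypergeo_2F1_quadratic[OF this _ quad, of "of_real a"]
    moreover have "2 * complex_of_real \<alpha> = of_real (2 * \<alpha>)"
      "complex_of_real \<alpha> + 1 / 2 = of_real (\<alpha> + 1 / 2)"
      "4 * complex_of_real r / (1 + of_real r)\<^sup>2 = of_real (1 - x\<^sup>2 / y\<^sup>2)"
      unfolding arg by simp_all
    moreover have "norm (complex_of_real r) < 1"
      using r(1,2) by simp
    ultimately show ?thesis
      unfolding G_def by (simp only:)
  qed
  also have "(1 + complex_of_real r) powr (2 * of_real a) =
      of_real ((2 * y / (x + y)) powr (2 * \<alpha> + \<nu> - 1))"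
  proof -
    have exponent: "2 * a = 2 * \<alpha> + \<nu> - 1"
      by (simp add: a_def field_simps)
    have "(1 + complex_of_real r) powr (2 * of_real a) = of_real ((1 + r) powr (2 * a))"
      using powr_of_real[of "1 + r" "2 * a"] r(1) by simp
    then show ?thesis
      unfolding exponent r(3) .
  qed
  finally have lhs: "gauss_2F1 (of_real a) (of_real \<alpha>) (of_real (2 * \<alpha>)) (of_real (1 - x\<^sup>2 / y\<^sup>2)) =
      of_real ((2 * y / (x + y)) powr (2 * \<alpha> + \<nu> - 1)) * eval_fps G ((of_real r)\<^sup>2)" .
  \<comment> \<open>Negativity puts z in the half-plane of Pfaff's transformation, even where z lies
    outside the unit disc.\<close>
  have "z < 0"
    unfolding z_def using x y by (intro divide_neg_pos) auto
  moreover have "(1 - w) / 2 = z" "1 - z = (x + y)\<^sup>2 / (4 * x * y)"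
    using x y unfolding w_def z_def by (auto simp: field_simps power2_eq_square)
  ultimately have z: "(1 - w) / 2 = z" "z < 0" "1 - z = (x + y)\<^sup>2 / (4 * x * y)"
    by auto
  have "z / (z - 1) = - z / (1 - z)"
    by (simp add: minus_divide_right)
  also have "\<dots> = r\<^sup>2"
    using x y unfolding z(3) unfolding z_def r_def by (simp add: power_divide)
  finally have z_arg: "of_real z / (of_real z - 1) = (complex_of_real r)\<^sup>2"
    by (metis of_real_1 of_real_diff of_real_divide of_real_power)
  have "gauss_2F1 (of_real (1 - \<nu> / 2)) (of_real (\<nu> / 2)) (of_real (\<alpha> + 1 / 2)) (of_real z) =
      (1 - of_real z) powr (- of_real (\<nu> / 2)) *
      eval_fps (fps_hypergeo [of_real (\<nu> / 2), of_real (\<alpha> + 1 / 2) - of_real (1 - \<nu> / 2)]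
        [of_real (\<alpha> + 1 / 2)] 1) (of_real z / (of_real z - 1))"
    \<comment> \<open>Pfaff's transformation keeps the first upper parameter, so \<nu> / 2 is moved
      there; the other one then turns into \<alpha> + 1/2 - (1 - \<nu> / 2) = a.\<close>
    unfolding gauss_2F1_commute[of "of_real (1 - \<nu> / 2)"]
    using \<alpha> z(2) by (intro gauss_2F1_pfaff nonpole) auto
  also have "complex_of_real (\<alpha> + 1 / 2) - of_real (1 - \<nu> / 2) = of_real a"
    by (simp add: a_def field_simps)
  also have "(1 - complex_of_real z) powr (- of_real (\<nu> / 2)) =
      of_real (((x + y)\<^sup>2 / (4 * x * y)) powr (- \<nu> / 2))"
    using powr_of_real[of "1 - z" "- \<nu> / 2"] z(2) unfolding z(3)[symmetric] by simp
  finally have rhs: "gauss_2F1 (of_real (1 - \<nu> / 2)) (of_real (\<nu> / 2)) (of_real (\<alpha> + 1 / 2)) (of_real z) =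
      of_real (((x + y)\<^sup>2 / (4 * x * y)) powr (- \<nu> / 2)) * eval_fps G ((of_real r)\<^sup>2)"
    unfolding z_arg G_def fps_hypergeo_2F1_commute[of "of_real (\<nu> / 2)"] .
  have "w + 1 = (x + y)\<^sup>2 / (2 * x * y)" "w - 1 = (y - x)\<^sup>2 / (2 * x * y)"
    using x y by (auto simp: w_def field_simps power2_eq_square)
  then have w: "(w + 1) / (w - 1) = ((x + y) / (y - x))\<^sup>2"
    using x y by (simp add: power_divide)
  have Gamma: "Gamma (\<alpha> + 1 / 2) \<noteq> 0"
    by (rule less_imp_neq[OF Gamma_real_pos, symmetric]) (use \<alpha> in simp)
  have legendre: "legendre_P (\<nu> / 2 - 1) (1 / 2 - \<alpha>) w =
      of_real (1 / Gamma (\<alpha> + 1 / 2) * (((x + y) / (y - x))\<^sup>2) powr ((1 / 2 - \<alpha>) / 2) *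
        ((x + y)\<^sup>2 / (4 * x * y)) powr (- \<nu> / 2)) * eval_fps G ((of_real r)\<^sup>2)"
  proof -
    have "- (\<nu> / 2 - 1) = 1 - \<nu> / 2" "\<nu> / 2 - 1 + 1 = \<nu> / 2" "1 - (1 / 2 - \<alpha>) = \<alpha> + 1 / 2"
      by auto
    then show ?thesis
      unfolding legendre_P_def w z(1) by (simp only: rhs of_real_mult mult.assoc)
  qed
  \<comment> \<open>The common series value is kept as an opaque \<open>c\<close>, which isolates
    the identity between real factors.\<close>
  have combine: "of_real k * (of_real l * c) = of_real (g * (p * q)) * (of_real (1 / g * u * v) * c)"
    if "k * l = p * q * u * v" "g \<noteq> 0" for k l g p q u v :: real and c :: complex
  proof -
    have "k * l = g * (p * q) * (1 / g * u * v)"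
      using that by simp
    then show ?thesis
      by (simp only: mult.assoc[of _ _ c, symmetric] of_real_mult[symmetric])
  qed
  show ?thesis
    unfolding lhs[unfolded a_def] w_def[symmetric] legendre
    by (rule combine[OF kernel_powr_identity[OF x] Gamma])
qed

theorem mainTheorem1:
  fixes \<nu> \<alpha> a b x :: real and f :: "real \<Rightarrow> complex"
  assumes "\<nu> \<ge> 0" and "\<alpha> > 0"
    and "smooth_on {0<..} f"
    and "0 < a" and "a < b"
    and "closure {y \<in> {0<..}. f y \<noteq> 0} = {a..b}"
    and "x > 0"
  shows "bessel_integral \<nu> \<alpha> f x =
     of_real (Gamma (\<alpha> + 1 / 2) / Gamma (2 * \<alpha>)) *
     (LINT y:{x<..}|lborel.
        of_real ((y\<^sup>2 - x\<^sup>2) powr (\<alpha> - 1 / 2) * (y / x) powr (\<nu> / 2)) *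
        legendre_P (\<nu> / 2 - 1) (1 / 2 - \<alpha>) (1 / 2 * (x / y + y / x)) *
        f y)"
proof -
  have "bessel_integral \<nu> \<alpha> f x = of_real (1 / Gamma (2 * \<alpha>)) *
     (LINT y:{x<..}|lborel. of_real (Gamma (\<alpha> + 1 / 2)) *
        (of_real ((y\<^sup>2 - x\<^sup>2) powr (\<alpha> - 1 / 2) * (y / x) powr (\<nu> / 2)) *
        legendre_P (\<nu> / 2 - 1) (1 / 2 - \<alpha>) (1 / 2 * (x / y + y / x)) *
        f y))"
    unfolding bessel_integral_def
  \<comment> \<open>The kernels agree at every y > x, so the integrands are equal pointwise on the
    range of integration.\<close>
  proof (rule arg_cong2[where f = "(*)", OF refl], intro set_lebesgue_integral_cong allI impI)
    fix y assume "y \<in> {x<..}"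
    then have "x < y"
      by simp
    from bessel_kernel_eq_legendre[OF \<open>\<alpha> > 0\<close> \<open>x > 0\<close> this, of \<nu>]
    show "of_real (((y\<^sup>2 - x\<^sup>2) / (2 * y)) powr (2 * \<alpha> - 1)) *
        gauss_2F1 (of_real (\<alpha> + (\<nu> - 1) / 2)) (of_real \<alpha>) (of_real (2 * \<alpha>))
          (of_real (1 - x\<^sup>2 / y\<^sup>2)) * f y =
        of_real (Gamma (\<alpha> + 1 / 2)) *
        (of_real ((y\<^sup>2 - x\<^sup>2) powr (\<alpha> - 1 / 2) * (y / x) powr (\<nu> / 2)) *
        legendre_P (\<nu> / 2 - 1) (1 / 2 - \<alpha>) (1 / 2 * (x / y + y / x)) *
        f y)"
      by (simp only: of_real_mult mult.assoc)
  qed auto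
  also have "\<dots> = of_real (Gamma (\<alpha> + 1 / 2) / Gamma (2 * \<alpha>)) *
     (LINT y:{x<..}|lborel.
        of_real ((y\<^sup>2 - x\<^sup>2) powr (\<alpha> - 1 / 2) * (y / x) powr (\<nu> / 2)) *
        legendre_P (\<nu> / 2 - 1) (1 / 2 - \<alpha>) (1 / 2 * (x / y + y / x)) *
        f y)"
    by (subst set_integral_mult_right) simp
  finally show ?thesis .
qed

end
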